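(* Let pdqsort (as described in the context) be run on an array $A[0..n-1]$ whose elements take exactly $k$ distinct values, i.e. the relation "compare equal" has exactly $k$ equivalence classes on the elements of $A$. Then the running time of pdqsort on this input is $O(nk)$.
   Context: Setting. The input is an array $A[0..n-1]$ ($n\ge 1$) of elements compared by a strict weak ordering $<$. Two elements $a,b$ compare equal if neither $a<b$ nor $b<a$; this is an equivalence relation whose classes are called distinct values; $a\le b$ means "not $b<a$". Running time counts elementary operations, each comparison or element move costing $O(1)$. Pattern-defeating quicksort (pdqsort) has fixed constants: an insertion-sort threshold $c\ge 3$, a bad-partition parameter $p\in(0,1)$ (the reference implementation uses $p=1/8$), and a constant bound on element moves for a partial insertion sort. It is the following recursive procedure acting in place on contiguous subarrays $A[a..b)=(A[a],\dots,A[b-1])$, each call carrying an integer counter $t$; the top-level call is on $A[0..n)$ with $t=\lfloor\log_2 n\rfloor$. A subarray $A[a..b)$ is leftmost if $a=0$; otherwise its predecessor is the element currently at position $a-1$. A call on $A[a..b)$ with $m=b-a$ and counter $t$ does: (1) if $m\le c$, sort $A[a..b)$ by insertion sort and return; (2) if $t=0$, sort $A[a..b)$ by heapsort and return; (3) select a pivot $q$ from $A[a..b)$ as the median of at least three sampled elements of $A[a..b)$ (median of three, or Tukey's ninther for large $m$) by a deterministic rule using $O(1)$ comparisons, and move it to position $a$; (4) if $a>0$ and the predecessor compares equal to $q$, apply partition_left: in $O(m)$ time rearrange $A[a..b)$ so that $q$ ends at a position $r$, every element of $A[a..r)$ is $\le q$ and every element of $A[r+1..b)$ is $>q$. Otherwise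 apply partition_right: in $O(m)$ time rearrange $A[a..b)$ so that $q$ ends at a position $r$, every element of $A[a..r)$ is $<q$ and every element of $A[r+1..b)$ is $\ge q$; (5) the partition is bad if $\min(r-a,\,b-r-1)<p\,m$, and good otherwise; if it is bad, set $t:=t-1$ and swap $O(1)$ elements at fixed relative positions inside each of the two parts; (6) if partition_right was applied, the partition is good, and the partition step moved no element other than the pivot, run on each of $A[a..r)$ and $A[r+1..b)$ an insertion sort that aborts after the constant number of element moves; if both complete, return; (7) if partition_left was applied, recurse only on $A[r+1..b)$ with counter $t$; otherwise recurse on $A[a..r)$ and then on $A[r+1..b)$, each with counter $t$. The counter is local to each call (decrements in one subtree do not affect other subtrees). *)

theory Defs
  imports Complex_Main "HOL-Combinatorics.Permutations" "HOL-Library.Extended_Nat"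
begin

section \<open>Strict weak orderings\<close>

definition compares_equal :: "('a \<Rightarrow> 'a \<Rightarrow> bool) \<Rightarrow> 'a \<Rightarrow> 'a \<Rightarrow> bool" where
  "compares_equal lt x y \<longleftrightarrow> \<not> lt x y \<and> \<not> lt y x"

definition strict_weak_order :: "('a \<Rightarrow> 'a \<Rightarrow> bool) \<Rightarrow> bool" where
  "strict_weak_order lt \<longleftrightarrow> irreflp lt \<and> transp lt \<and> transp (compares_equal lt)"

definition distinct_values :: "('a \<Rightarrow> 'a \<Rightarrow> bool) \<Rightarrow> 'a list \<Rightarrow> 'a set set" where
  "distinct_values lt A =
     set A // {(x, y). x \<in> set A \<and> y \<in> set A \<and> compares_equal lt x y}"

text \<open>For an index set \<open>S\<close> of odd size this says that \<open>xs ! j\<close> is the middle element of the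
  sample in sorted order; for even size both middle elements qualify.\<close>

definition is_median :: "('a \<Rightarrow> 'a \<Rightarrow> bool) \<Rightarrow> 'a list \<Rightarrow> nat set \<Rightarrow> nat \<Rightarrow> bool" where
  "is_median lt xs S j \<longleftrightarrow>
     j \<in> S \<and>
     2 * card {i \<in> S. lt (xs ! i) (xs ! j)} \<le> card S \<and>
     2 * card {i \<in> S. lt (xs ! j) (xs ! i)} \<le> card S"


section \<open>Arrays\<close>

definition slice :: "'a list \<Rightarrow> nat \<Rightarrow> nat \<Rightarrow> 'a list" where
  "slice A a b = take (b - a) (drop a A)"

definition overwrite :: "'a list \<Rightarrow> nat \<Rightarrow> 'a list \<Rightarrow> 'a list" where
  "overwrite A a xs = take a A @ xs @ drop (a + length xs) A"

definition swap :: "nat \<Rightarrow> nat \<Rightarrow> 'a list \<Rightarrow> 'a list" where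
  "swap i j xs = xs[i := xs ! j, j := xs ! i]"

fun apply_swaps :: "(nat \<times> nat) list \<Rightarrow> 'a list \<Rightarrow> 'a list" where
  "apply_swaps [] xs = xs"
| "apply_swaps ((i, j) # ps) xs = apply_swaps ps (swap i j xs)"


section \<open>Insertion sort and heapsort with operation counts\<close>

text \<open>Throughout, a comparison costs 1 and an exchange of two array entries costs 3 moves.  In
  insertion sort, shifting one element by one place (here an exchange with the element being
  inserted) counts as one move.

  The argument \<open>B\<close> is the number of moves that may still be made: \<open>\<infinity>\<close> for ordinary insertion
  sort, finite for the variant that aborts.  The results are the array, the remaining number of
  moves, the cost, and whether the insertion was completed.\<close>

fun insert_back ::
  "('a \<Rightarrow> 'a \<Rightarrow> bool) \<Rightarrow> enat \<Rightarrow> nat \<Rightarrow> 'a list \<Rightarrow> 'a list \<times> enat \<times> nat \<times> bool" where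
  "insert_back lt B 0 xs = (xs, B, 0, True)"
| "insert_back lt B (Suc j) xs =
     (if \<not> lt (xs ! Suc j) (xs ! j) then (xs, B, 1, True)
      else if B = 0 then (xs, B, 1, False)
      else let (ys, B', w, ok) = insert_back lt (B - 1) j (swap j (Suc j) xs)
           in (ys, B', w + 2, ok))"

fun insertion_loop ::
  "('a \<Rightarrow> 'a \<Rightarrow> bool) \<Rightarrow> enat \<Rightarrow> nat list \<Rightarrow> 'a list \<Rightarrow> 'a list \<times> nat \<times> bool" where
  "insertion_loop lt B [] xs = (xs, 0, True)"
| "insertion_loop lt B (i # is) xs =
     (let (ys, B', w, ok) = insert_back lt B i xs
      in if ok then let (zs, w', ok') = insertion_loop lt B' is ys in (zs, w + w', ok')
         else (ys, w, False))"

definition insertion_sort ::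
  "('a \<Rightarrow> 'a \<Rightarrow> bool) \<Rightarrow> enat \<Rightarrow> 'a list \<Rightarrow> 'a list \<times> nat \<times> bool" where
  "insertion_sort lt B xs = insertion_loop lt B [1..<length xs] xs"

text \<open>The heap occupies the first \<open>n\<close> positions of the list, with the children of \<open>i\<close> at
  \<open>2 * i + 1\<close> and \<open>2 * i + 2\<close> and the maximum at the root.\<close>

function sift_down :: "('a \<Rightarrow> 'a \<Rightarrow> bool) \<Rightarrow> nat \<Rightarrow> nat \<Rightarrow> 'a list \<Rightarrow> 'a list \<times> nat" where
  "sift_down lt n i xs =
     (if n \<le> 2 * i + 1 then (xs, 1)
      else let j = (if 2 * i + 2 < n \<and> lt (xs ! (2 * i + 1)) (xs ! (2 * i + 2))
                    then 2 * i + 2 else 2 * i + 1)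
           in if lt (xs ! i) (xs ! j)
              then let (ys, w) = sift_down lt n j (swap i j xs) in (ys, w + 5)
              else (xs, 2))"
  by pat_completeness auto
termination
  by (relation "measure (\<lambda>(lt, n, i, xs). n - i)") auto

declare sift_down.simps [simp del]

fun build_heap :: "('a \<Rightarrow> 'a \<Rightarrow> bool) \<Rightarrow> nat \<Rightarrow> nat \<Rightarrow> 'a list \<Rightarrow> 'a list \<times> nat" where
  "build_heap lt n 0 xs = (xs, 0)"
| "build_heap lt n (Suc i) xs =
     (let (ys, w) = sift_down lt n i xs; (zs, w') = build_heap lt n i ys in (zs, w + w'))"

fun extract_all :: "('a \<Rightarrow> 'a \<Rightarrow> bool) \<Rightarrow> nat \<Rightarrow> 'a list \<Rightarrow> 'a list \<times> nat" where
  "extract_all lt 0 xs = (xs, 0)"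
| "extract_all lt (Suc n) xs =
     (let (ys, w) = sift_down lt n 0 (swap 0 n xs); (zs, w') = extract_all lt n ys
      in (zs, 3 + w + w'))"

definition heapsort :: "('a \<Rightarrow> 'a \<Rightarrow> bool) \<Rightarrow> 'a list \<Rightarrow> 'a list \<times> nat" where
  "heapsort lt xs =
     (let m = length xs; (ys, w) = build_heap lt m (m div 2) xs; (zs, w') = extract_all lt m ys
      in (zs, w + w'))"


section \<open>Pattern-defeating quicksort\<close>

text \<open>The constants are the insertion sort threshold \<open>c\<close>, the bad-partition parameter \<open>p\<close>, the
  move bound \<open>L\<close> of the partial insertion sort, and a common bound \<open>K\<close> for the implied constants
  of the subroutines.

  The subroutines act on the current subarray, with positions relative to its start.  Pivot
  selection and partitioning return the rearrangement they carry out as a permutation \<open>f\<close> of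
  positions (the entry moved to position \<open>i\<close> comes from position \<open>f i\<close>) and their cost;
  partitioning expects the pivot at position 0 and also returns its final position \<open>r\<close>.

  Tukey's ninther is the median of three sampled elements that are themselves medians of three, so
  it satisfies the condition on pivot selection.\<close>

locale pdqsort =
  fixes lt :: "'a \<Rightarrow> 'a \<Rightarrow> bool"
    and c :: nat and p :: real and L K :: nat
    and select_pivot :: "'a list \<Rightarrow> (nat \<Rightarrow> nat) \<times> nat"
    and partition_left partition_right :: "'a list \<Rightarrow> (nat \<Rightarrow> nat) \<times> nat \<times> nat"
    and swaps_left swaps_right :: "nat \<Rightarrow> (nat \<times> nat) list"
  assumes order: "strict_weak_order lt"
    and threshold: "3 \<le> c"
    and bad_parameter: "0 < p" "p < 1"
    and select_pivot:
      "\<And>xs f w. \<lbrakk>c < length xs; select_pivot xs = (f, w)\<rbrakk> \<Longrightarrow>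
         f permutes {..<length xs} \<and> w \<le> K \<and>
         (\<exists>S \<subseteq> {..<length xs}. 3 \<le> card S \<and> is_median lt xs S (f 0))"
    and partition_left:
      "\<And>xs f r w. \<lbrakk>c < length xs; partition_left xs = (f, r, w)\<rbrakk> \<Longrightarrow>
         f permutes {..<length xs} \<and> w \<le> K * length xs \<and> r < length xs \<and> f r = 0 \<and>
         (\<forall>i<r. \<not> lt (xs ! 0) (xs ! f i)) \<and>
         (\<forall>i. r < i \<and> i < length xs \<longrightarrow> lt (xs ! 0) (xs ! f i))"
    and partition_right:
      "\<And>xs f r w. \<lbrakk>c < length xs; partition_right xs = (f, r, w)\<rbrakk> \<Longrightarrow>
         f permutes {..<length xs} \<and> w \<le> K * length xs \<and> r < length xs \<and> f r = 0 \<and>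
         (\<forall>i<r. lt (xs ! f i) (xs ! 0)) \<and>
         (\<forall>i. r < i \<and> i < length xs \<longrightarrow> \<not> lt (xs ! f i) (xs ! 0))"
    and swaps_left:
      "\<And>l. length (swaps_left l) \<le> K \<and> set (swaps_left l) \<subseteq> {..<l} \<times> {..<l}"
    and swaps_right:
      "\<And>l. length (swaps_right l) \<le> K \<and> set (swaps_right l) \<subseteq> {..<l} \<times> {..<l}"
begin

text \<open>The work between partitioning and recursion, on the parts \<open>lo\<close> and \<open>hi\<close> before and after
  the pivot; the last component of the result says whether both parts were found to be sorted.
  A partition step moves no element but the pivot if all it does is to exchange the pivot with the
  entry at its final position; this is the meaning given to \<open>unmoved\<close> below.\<close>

definition adjust_parts ::
  "bool \<Rightarrow> bool \<Rightarrow> 'a list \<Rightarrow> 'a list \<Rightarrow> 'a list \<times> 'a list \<times> nat \<times> bool" where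
  "adjust_parts bad try_insertion lo hi =
     (if bad then
        let ps = swaps_left (length lo); qs = swaps_right (length hi)
        in (apply_swaps ps lo, apply_swaps qs hi, 3 * length ps + 3 * length qs, False)
      else if try_insertion then
        let (lo', w, ok) = insertion_sort lt (enat L) lo;
            (hi', w', ok') = insertion_sort lt (enat L) hi
        in (lo', hi', w + w', ok \<and> ok')
      else (lo, hi, 0, False))"

lemma pivot_position_less:
  assumes "xs = slice A a b" "m = length xs" "\<not> m \<le> c" "ys = permute_list f xs"
    and "u = (if left then partition_left ys else partition_right ys)" "(g, v) = u" "(r, w) = v"
  shows "r < b - a"
proof -
  have len: "length ys = length xs"
    using assms(4) by simp
  then have "c < length ys"
    using assms(2,3) by simp
  then have "r < length ys"
    using assms(5-7) partition_left partition_right by (metis (full_types))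
  then show ?thesis
    using len assms(1) by (simp add: slice_def)
qed

text \<open>The result is the final array and the cost; the summand 1 accounts for the administrative
  work of a call.  All calls made have \<open>a \<le> b \<le> length A\<close>, so that \<open>m = b - a\<close>;
  writing \<open>m\<close> as a length makes termination hold for arbitrary arguments.\<close>

function pdq :: "'a list \<Rightarrow> nat \<Rightarrow> nat \<Rightarrow> nat \<Rightarrow> 'a list \<times> nat" where
  "pdq A a b t =
     (let xs = slice A a b; m = length xs in
      if m \<le> c then
        let (ys, w, _) = insertion_sort lt \<infinity> xs in (overwrite A a ys, 1 + w)
      else if t = 0 then
        let (ys, w) = heapsort lt xs in (overwrite A a ys, 1 + w)
      else
        let (f, w1) = select_pivot xs;
            ys = permute_list f xs;
            q = ys ! 0;
            left = (a > 0 \<and> compares_equal lt (A ! (a - 1)) q);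
            (g, r, w2) = (if left then partition_left ys else partition_right ys);
            zs = permute_list g ys;
            bad = (real (min r (m - r - 1)) < p * real m);
            unmoved = (g = Transposition.transpose 0 r);
            t' = (if bad then t - 1 else t);
            (lo, hi, w3, finished) =
              adjust_parts bad (\<not> left \<and> unmoved) (take r zs) (drop (Suc r) zs);
            A' = overwrite A a (lo @ q # hi);
            w = 1 + w1 + w2 + w3
        in if finished then (A', w)
           else if left then
             let (A1, v1) = pdq A' (a + r + 1) b t' in (A1, w + v1)
           else
             let (A1, v1) = pdq A' a (a + r) t';
                 (A2, v2) = pdq A1 (a + r + 1) b t'
             in (A2, w + v1 + v2))"
  by pat_completeness auto
termination
proof (relation "measure (\<lambda>(A, a, b, t). b - a)", goal_cases)
  case 1
  show ?case by (rule wf_measure)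
next
  case (2 A a b)
  from pivot_position_less[OF 2(1,2,3,7,10,11,12)] show ?case
    unfolding in_measure split_conv by linarith
next
  case (3 A a b)
  from pivot_position_less[OF 3(1,2,3,7,10,11,12)] show ?case
    unfolding in_measure split_conv by linarith
next
  case (4 A a b)
  from pivot_position_less[OF 4(1,2,3,7,10,11,12)] show ?case
    unfolding in_measure split_conv by linarith
qed

definition running_time :: "'a list \<Rightarrow> nat" where
  "running_time A = snd (pdq A 0 (length A) (nat \<lfloor>log 2 (real (length A))\<rfloor>))"

end

end

theory Submission
  imports Defs
begin

text \<open>No entry of a subarray is less than its predecessor.  Hence, along a path of recursive calls,
  a value is the pivot of at most one partition_right and one partition_left: after the former
  it is gone from the left part and is the predecessor of the right part, and the latter removes it.
  So the recursion has depth at most \<open>2 * k\<close>, and each level costs \<open>O(n)\<close> apart from heapsort.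
  Heapsort is entered only after \<open>log n\<close> bad partitions on one path, which forces
  \<open>log n \<le> 2 * k\<close> up to rounding, so its total cost \<open>O(n * log n)\<close> is \<open>O(n * k)\<close> as well.\<close>

section \<open>Costs of the subroutines\<close>

lemma length_swap [simp]: "length (swap i j xs) = length xs"
  by (simp add: swap_def)

text \<open>Here and below only inclusions of entry sets are recorded: the rank is bounded through
  subsets of the entries and does not see multiplicities.\<close>

lemma set_swap_subset: "i < length xs \<Longrightarrow> j < length xs \<Longrightarrow> set (swap i j xs) \<subseteq> set xs"
  by (auto simp: swap_def dest!: set_update_subset_insert[THEN subsetD])

lemma length_apply_swaps [simp]: "length (apply_swaps ps xs) = length xs"
  by (induction ps xs rule: apply_swaps.induct) auto

lemma set_apply_swaps_subset:
  "set ps \<subseteq> {..<length xs} \<times> {..<length xs} \<Longrightarrow> set (apply_swaps ps xs) \<subseteq> set xs"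
proof (induction ps xs rule: apply_swaps.induct)
  case (2 i j ps xs)
  then show ?case
    using set_swap_subset[of i xs j] by auto
qed auto

section \<open>Insertion sort, with and without a bound on moves\<close>

lemma insert_back_length_set:
  assumes "insert_back lt B i xs = (ys, B', w, ok)" "i < length xs"
  shows "length ys = length xs \<and> set ys \<subseteq> set xs"
  using assms
proof (induction lt B i xs arbitrary: ys B' w ok rule: insert_back.induct)
  case (2 lt B j xs)
  have sub: "set (swap j (Suc j) xs) \<subseteq> set xs"
    using 2(3) by (intro set_swap_subset) auto
  show ?case
    using 2 sub by (fastforce split: if_splits prod.splits)
qed auto

lemma insert_back_cost:
  "insert_back lt B i xs = (ys, B', w, ok) \<Longrightarrow> w \<le> 2 * i + 1"
  by (induction lt B i xs arbitrary: ys B' w ok rule: insert_back.induct)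
    (fastforce split: if_splits prod.splits)+

text \<open>The remaining moves act as a potential: a shift costs 2, one comparison and one move,
  and uses up one unit of the budget. The 1 is for a final comparison without a move.\<close>

lemma insert_back_budget_cost:
  assumes "insert_back lt (enat B) i xs = (ys, B', w, ok)"
  shows "\<exists>R. B' = enat R \<and> w + 2 * R \<le> 2 * B + 1"
  using assms
proof (induction i arbitrary: B xs ys B' w ok)
  case (Suc j)
  show ?case
  proof (cases "lt (xs ! Suc j) (xs ! j) \<and> B \<noteq> 0")
    case True
    obtain v where v: "insert_back lt (enat (B - 1)) j (swap j (Suc j) xs) = (ys, B', v, ok)"
      and w: "w = v + 2"
      using Suc.prems True by (auto simp: one_enat_def zero_enat_def split: prod.splits)
    show ?thesis
      using Suc.IH[OF v] w True by auto
  next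
    case False
    then show ?thesis
      using Suc.prems by (auto simp: zero_enat_def split: if_splits)
  qed
qed auto

lemma insertion_loop_length_set:
  assumes "insertion_loop lt B is xs = (ys, w, ok)" "set is \<subseteq> {..<length xs}"
  shows "length ys = length xs \<and> set ys \<subseteq> set xs"
  using assms
proof (induction lt B "is" xs arbitrary: ys w ok rule: insertion_loop.induct)
  case (2 lt B i "is" xs)
  obtain us B' v good where step: "insert_back lt B i xs = (us, B', v, good)"
    by (metis prod_cases4)
  have us: "length us = length xs" "set us \<subseteq> set xs"
    using insert_back_length_set[OF step] 2(3) by auto
  show ?case
    using 2 step us by (fastforce split: if_splits prod.splits)
qed auto

lemma insertion_loop_cost:
  assumes "insertion_loop lt B is xs = (ys, w, ok)" "\<forall>i\<in>set is. i \<le> m"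
  shows "w \<le> length is * (2 * m + 1)"
  using assms
proof (induction lt B "is" xs arbitrary: ys w ok rule: insertion_loop.induct)
  case (2 lt B i "is" xs)
  obtain us B' v good where step: "insert_back lt B i xs = (us, B', v, good)"
    by (metis prod_cases4)
  have v: "v \<le> 2 * m + 1"
    using insert_back_cost[OF step] 2(3) by simp
  show ?case
  proof (cases good)
    case True
    obtain zs w' ok' where rest: "insertion_loop lt B' is us = (zs, w', ok')"
      by (metis prod_cases3)
    have "w' \<le> length is * (2 * m + 1)"
      using "2.IH"[OF step[symmetric] refl refl refl True rest] 2(3) by simp
    then show ?thesis
      using 2(2) step True rest v by auto
  next
    case False
    then show ?thesis
      using 2(2) step v by auto
  qed
qed auto

text \<open>The potentials telescope: all insertions share the budget, and each adds only one
  comparison. This makes the aborting sort linear in the length.\<close>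

lemma insertion_loop_budget_cost:
  assumes "insertion_loop lt (enat B) is xs = (ys, w, ok)"
  shows "w \<le> 2 * B + length is"
  using assms
proof (induction "is" arbitrary: B xs ys w ok)
  case (Cons i "is")
  obtain us B' v good where step: "insert_back lt (enat B) i xs = (us, B', v, good)"
    by (metis prod_cases4)
  obtain R where R: "B' = enat R" "v + 2 * R \<le> 2 * B + 1"
    using insert_back_budget_cost[OF step] by blast
  obtain zs w' ok' where rest: "insertion_loop lt (enat R) is us = (zs, w', ok')"
    by (metis prod_cases3)
  show ?case
    using Cons.prems step R Cons.IH[OF rest] rest by (auto split: if_splits)
qed auto

lemma insertion_sort_length_set:
  "insertion_sort lt B xs = (ys, w, ok) \<Longrightarrow> length ys = length xs \<and> set ys \<subseteq> set xs"
  unfolding insertion_sort_def by (erule insertion_loop_length_set) auto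

lemma insertion_sort_cost:
  assumes "insertion_sort lt B xs = (ys, w, ok)"
  shows "w \<le> length xs * (2 * length xs + 1)"
proof -
  have "w \<le> length [1..<length xs] * (2 * length xs + 1)"
    using assms unfolding insertion_sort_def by (rule insertion_loop_cost) auto
  also have "\<dots> \<le> length xs * (2 * length xs + 1)"
    by (intro mult_le_mono1) simp
  finally show ?thesis .
qed

lemma insertion_sort_budget_cost:
  "insertion_sort lt (enat B) xs = (ys, w, ok) \<Longrightarrow> w \<le> 2 * B + length xs"
  unfolding insertion_sort_def by (drule insertion_loop_budget_cost) simp

section \<open>Heapsort\<close>

lemma sift_down_length: "length (fst (sift_down lt n i xs)) = length xs"
proof (induction lt n i xs rule: sift_down.induct)
  case (1 lt n i xs)
  then show ?case
    by (subst sift_down.simps) (auto simp: Let_def split: prod.splits)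
qed

text \<open>In one-based numbering the children of \<open>i + 1\<close> have numbers at least
  \<open>2 * (i + 1)\<close>, so the hypothesis passes to them with \<open>d - 1\<close>:
  \<open>d\<close> bounds the number of levels below \<open>i\<close>. A level costs 5, two
  comparisons and one exchange.\<close>

lemma sift_down_cost:
  "n \<le> (i + 1) * 2 ^ d \<Longrightarrow> snd (sift_down lt n i xs) \<le> 5 * d + 2"
proof (induction d arbitrary: i xs)
  case 0
  then show ?case
    by (subst sift_down.simps) auto
next
  case (Suc d)
  have child: "snd (sift_down lt n j (swap i j xs)) \<le> 5 * d + 2" if "2 * i + 1 \<le> j" for j
  proof (rule Suc.IH)
    have "n \<le> (2 * i + 2) * 2 ^ d"
      using Suc.prems by (simp add: algebra_simps)
    also have "\<dots> \<le> (j + 1) * 2 ^ d"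
      using that by (intro mult_le_mono1) simp
    finally show "n \<le> (j + 1) * 2 ^ d" .
  qed
  show ?case
    using child[of "2 * i + 1"] child[of "2 * i + 2"]
    by (subst sift_down.simps) (auto simp: Let_def split: prod.splits)
qed

lemma sift_down_cost_le:
  assumes "n \<le> 2 ^ s"
  shows "snd (sift_down lt n i xs) \<le> 5 * s + 2"
proof (rule sift_down_cost)
  show "n \<le> (i + 1) * 2 ^ s"
    using assms by (simp add: trans_le_add1)
qed

lemma build_heap_length: "length (fst (build_heap lt n i xs)) = length xs"
proof (induction lt n i xs rule: build_heap.induct)
  case (2 lt n i xs)
  then show ?case
    using sift_down_length[of lt n i xs] by (auto split: prod.splits)
qed simp

text \<open>Charging the full heap depth to every sift is crude, but extraction is charged at the
  same order anyway.\<close>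

lemma build_heap_cost:
  assumes "n \<le> 2 ^ s"
  shows "snd (build_heap lt n i xs) \<le> i * (5 * s + 2)"
proof (induction i arbitrary: xs)
  case (Suc i)
  obtain ys w where step: "sift_down lt n i xs = (ys, w)"
    by fastforce
  have "w \<le> 5 * s + 2"
    using sift_down_cost_le[OF assms, of lt i xs] step by simp
  then show ?case
    using Suc[of ys] step by (auto split: prod.splits)
qed simp

lemma extract_all_length: "length (fst (extract_all lt n xs)) = length xs"
proof (induction lt n xs rule: extract_all.induct)
  case (2 lt n xs)
  then show ?case
    using sift_down_length[of lt n 0 "swap 0 n xs"] by (auto split: prod.splits)
qed simp

lemma extract_all_cost: "n \<le> 2 ^ s \<Longrightarrow> snd (extract_all lt n xs) \<le> n * (5 * s + 5)"
proof (induction n arbitrary: xs)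
  case (Suc n)
  obtain ys w where step: "sift_down lt n 0 (swap 0 n xs) = (ys, w)"
    by fastforce
  have "w \<le> 5 * s + 2"
    using sift_down_cost_le[of n s lt 0 "swap 0 n xs"] step Suc.prems by simp
  then show ?case
    using Suc.IH[of ys] Suc.prems step by (auto split: prod.splits)
qed simp

lemma heapsort_length: "length (fst (heapsort lt xs)) = length xs"
  using build_heap_length[of lt "length xs" "length xs div 2" xs]
  by (auto simp: heapsort_def Let_def split: prod.splits dest!: arg_cong[of _ _ fst])
    (metis extract_all_length)

text \<open>Per entry, construction contributes at most \<open>5 * s + 2\<close> and extraction
  \<open>5 * s + 5\<close>; the sum \<open>10 * s + 7\<close> is rounded up.\<close>

lemma heapsort_cost:
  assumes "length xs \<le> 2 ^ s"
  shows "snd (heapsort lt xs) \<le> length xs * (10 * (s + 1))"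
proof -
  let ?m = "length xs"
  obtain ys w where b: "build_heap lt ?m (?m div 2) xs = (ys, w)"
    by fastforce
  obtain zs v where e: "extract_all lt ?m ys = (zs, v)"
    by fastforce
  have "w \<le> (?m div 2) * (5 * s + 2)"
    using build_heap_cost[OF assms, of lt "?m div 2" xs] b by simp
  also have "\<dots> \<le> ?m * (5 * s + 2)"
    by (intro mult_le_mono1) simp
  finally have "w \<le> ?m * (5 * s + 2)" .
  moreover have "v \<le> ?m * (5 * s + 5)"
    using extract_all_cost[OF assms, of lt ys] e by simp
  ultimately show ?thesis
    using b e by (simp add: heapsort_def algebra_simps)
qed


section \<open>Counting values\<close>

text \<open>The class is formed in the whole type rather than in the array, so that classes of
  entries of different subarrays and of predecessors can be compared.\<close>

definition value_class :: "('a \<Rightarrow> 'a \<Rightarrow> bool) \<Rightarrow> 'a \<Rightarrow> 'a set" where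
  "value_class lt x = {y. compares_equal lt x y}"

text \<open>\<open>S\<close> is the set of entries of a subarray, and \<open>P\<close> contains its predecessor, if there is one.\<close>

definition rank :: "('a \<Rightarrow> 'a \<Rightarrow> bool) \<Rightarrow> 'a set \<Rightarrow> 'a set \<Rightarrow> nat" where
  "rank lt P S = card (value_class lt ` S) + card (value_class lt ` S - value_class lt ` P)"

lemma value_class_eq_iff:
  assumes "strict_weak_order lt"
  shows "value_class lt x = value_class lt y \<longleftrightarrow> compares_equal lt x y"
proof -
  have refl: "compares_equal lt z z" for z
    using assms by (auto simp: strict_weak_order_def compares_equal_def irreflp_def)
  have sym: "compares_equal lt u v \<Longrightarrow> compares_equal lt v u" for u v
    by (auto simp: compares_equal_def)
  have trans: "compares_equal lt u v \<Longrightarrow> compares_equal lt v w \<Longrightarrow> compares_equal lt u w" for u v w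
    using assms by (auto simp: strict_weak_order_def dest: transpD)
  show ?thesis
    unfolding value_class_def using refl sym trans by blast
qed

text \<open>Intersecting with the array turns these classes into those of
  \<open>distinct_values\<close>; this is injective because every entry lies in its own
  class.\<close>

lemma card_value_classes_le_distinct_values:
  assumes "strict_weak_order lt"
  shows "card (value_class lt ` set A) \<le> card (distinct_values lt A)"
proof (rule card_inj_on_le[where f = "\<lambda>X. X \<inter> set A"])
  show "inj_on (\<lambda>X. X \<inter> set A) (value_class lt ` set A)"
  proof (rule inj_onI, clarify)
    fix x y
    assume xy: "x \<in> set A" "y \<in> set A" "value_class lt x \<inter> set A = value_class lt y \<inter> set A"
    have "y \<in> value_class lt y"
      using value_class_eq_iff[OF assms, of y y] by (simp add: value_class_def)
    then show "value_class lt x = value_class lt y"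
      using xy unfolding value_class_eq_iff[OF assms] by (auto simp: value_class_def)
  qed
  show "(\<lambda>X. X \<inter> set A) ` value_class lt ` set A \<subseteq> distinct_values lt A"
    unfolding distinct_values_def value_class_def quotient_def by blast
  show "finite (distinct_values lt A)"
    unfolding distinct_values_def by (intro finite_quotient) auto
qed

section \<open>Bounds on the rank and its strict decrease\<close>

lemma rank_le_twice_distinct_values:
  assumes "strict_weak_order lt"
  shows "rank lt P (set A) \<le> 2 * card (distinct_values lt A)"
proof -
  have "card (value_class lt ` set A - value_class lt ` P) \<le> card (value_class lt ` set A)"
    by (intro card_mono) auto
  then show ?thesis
    using card_value_classes_le_distinct_values[OF assms, of A] unfolding rank_def by linarith
qed

lemma rank_pos: "finite S \<Longrightarrow> S \<noteq> {} \<Longrightarrow> 0 < rank lt P S"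
  by (auto simp: rank_def card_gt_0_iff)

text \<open>The first summand drops since the class of \<open>q\<close> disappears; the second
  cannot grow since \<open>P'\<close> excludes at least what \<open>P\<close> does. This serves the
  left part after \<open>partition_right\<close>, with \<open>P' = P\<close>, and the right part
  after \<open>partition_left\<close>, with \<open>P' = {q}\<close>.\<close>

lemma rank_less_if_pivot_value_removed:
  assumes "strict_weak_order lt" "finite S" "T \<subseteq> S" "q \<in> S"
    and "\<forall>x\<in>T. \<not> compares_equal lt q x"
    and "value_class lt ` P \<subseteq> value_class lt ` P'"
  shows "rank lt P' T < rank lt P S"
proof -
  have "value_class lt q \<notin> value_class lt ` T"
    using assms(1,5) by (auto simp: value_class_eq_iff)
  then have "value_class lt ` T \<subset> value_class lt ` S"
    using assms(3,4) by blast
  then have "card (value_class lt ` T) < card (value_class lt ` S)"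
    using assms(2) by (intro psubset_card_mono) auto
  moreover have "card (value_class lt ` T - value_class lt ` P')
      \<le> card (value_class lt ` S - value_class lt ` P)"
    using assms(2,3,6) by (intro card_mono) auto
  ultimately show ?thesis
    by (simp add: rank_def)
qed

text \<open>The right part after \<open>partition_right\<close> may still contain the value of
  \<open>q\<close>, so here it is the second summand that drops: \<open>q\<close> becomes the
  predecessor and its class is no longer counted there.\<close>

lemma rank_less_if_above_new_pivot:
  assumes "strict_weak_order lt" "finite S" "T \<subseteq> S" "q \<in> S"
    and T: "\<forall>x\<in>T. \<not> lt x q" and P: "\<forall>y\<in>P. lt y q"
  shows "rank lt {q} T < rank lt P S"
proof -
  have trans: "transp lt" and trans_eq: "transp (compares_equal lt)" and irrefl: "\<not> lt q q"
    using assms(1) by (auto simp: strict_weak_order_def irreflp_def)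
  \<comment> \<open>Replacing \<open>P\<close> by \<open>{q}\<close> must not bring an excluded
    class back: elements not below \<open>q\<close> lie strictly above all of
    \<open>P\<close>.\<close>
  have disj: "value_class lt x \<notin> value_class lt ` P" if "\<not> lt x q" for x
  proof
    assume "value_class lt x \<in> value_class lt ` P"
    then obtain y where y: "y \<in> P" "compares_equal lt x y"
      by (auto simp: value_class_eq_iff[OF assms(1)])
    then have "lt y q"
      using P by blast
    show False
    proof (cases "lt q x")
      case True
      then have "lt y x"
        using \<open>lt y q\<close> trans by (blast dest: transpD)
      then show False
        using y(2) by (simp add: compares_equal_def)
    next
      case False
      then have "compares_equal lt q x"
        using that by (simp add: compares_equal_def)
      then have "compares_equal lt q y"
        using y(2) trans_eq by (blast dest: transpD)
      then show False
        using \<open>lt y q\<close> by (simp add: compares_equal_def)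
    qed
  qed
  have "value_class lt q \<in> value_class lt ` S - value_class lt ` P"
    using assms(4) disj[OF irrefl] by blast
  moreover have "value_class lt ` T - value_class lt ` {q} \<subseteq> value_class lt ` S - value_class lt ` P"
    using assms(3) T disj by blast
  moreover have "value_class lt q \<notin> value_class lt ` T - value_class lt ` {q}"
    by simp
  ultimately have "value_class lt ` T - value_class lt ` {q} \<subset> value_class lt ` S - value_class lt ` P"
    by (metis psubsetI)
  then have "card (value_class lt ` T - value_class lt ` {q})
      < card (value_class lt ` S - value_class lt ` P)"
    using assms(2) by (intro psubset_card_mono) auto
  moreover have "card (value_class lt ` T) \<le> card (value_class lt ` S)"
    using assms(2,3) by (intro card_mono) auto
  ultimately show ?thesis
    by (simp add: rank_def)
qed


section \<open>The recursion\<close>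

text \<open>A set, so that a leftmost subarray needs no separate treatment.\<close>

definition predecessors :: "'a list \<Rightarrow> nat \<Rightarrow> 'a set" where
  "predecessors A a = (if a = 0 then {} else {A ! (a - 1)})"

section \<open>Slices and overwritten arrays\<close>

lemma length_slice: "a \<le> b \<Longrightarrow> b \<le> length A \<Longrightarrow> length (slice A a b) = b - a"
  by (simp add: slice_def)

lemma slice_nth: "a \<le> b \<Longrightarrow> b \<le> length A \<Longrightarrow> i < b - a \<Longrightarrow> slice A a b ! i = A ! (a + i)"
  by (simp add: slice_def)

lemma slice_eqI:
  assumes "length A = length B" "a \<le> b" "b \<le> length A" "\<And>i. a \<le> i \<Longrightarrow> i < b \<Longrightarrow> A ! i = B ! i"
  shows "slice A a b = slice B a b"
  using assms by (intro nth_equalityI) (auto simp: length_slice slice_nth)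

lemma length_overwrite: "a + length xs \<le> length A \<Longrightarrow> length (overwrite A a xs) = length A"
  by (simp add: overwrite_def)

lemma overwrite_nth:
  "a + length xs \<le> length A \<Longrightarrow> i < length A \<Longrightarrow>
   overwrite A a xs ! i = (if a \<le> i \<and> i < a + length xs then xs ! (i - a) else A ! i)"
  by (auto simp: overwrite_def nth_append)

section \<open>A single call and the positions it changes\<close>

context pdqsort
begin

declare pdq.simps [simp del]

text \<open>\<open>6 * K\<close> pays for at most \<open>K\<close> exchanges of cost 3 in each part,
  \<open>4 * L\<close> and the lengths for two partial insertion sorts; the sum bounds every
  branch.\<close>

lemma adjust_parts_length_set_cost:
  assumes "adjust_parts bad ti lo hi = (lo', hi', w, fin)"
  shows "length lo' = length lo" "length hi' = length hi" "set lo' \<subseteq> set lo" "set hi' \<subseteq> set hi"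
    and "w \<le> 6 * K + 4 * L + length lo + length hi"
proof -
  obtain l1 v1 k1 where l: "insertion_sort lt (enat L) lo = (l1, v1, k1)"
    by (metis prod_cases3)
  obtain h1 u1 j1 where h: "insertion_sort lt (enat L) hi = (h1, u1, j1)"
    by (metis prod_cases3)
  note facts = insertion_sort_length_set[OF l] insertion_sort_length_set[OF h]
    insertion_sort_budget_cost[OF l] insertion_sort_budget_cost[OF h]
    swaps_left[of "length lo"] swaps_right[of "length hi"]
    set_apply_swaps_subset[of "swaps_left (length lo)" lo]
    set_apply_swaps_subset[of "swaps_right (length hi)" hi]
  show "length lo' = length lo" "length hi' = length hi"
    and "w \<le> 6 * K + 4 * L + length lo + length hi"
    using assms facts l h by (auto simp: adjust_parts_def Let_def split: if_splits)
  show "set lo' \<subseteq> set lo" "set hi' \<subseteq> set hi"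
    using assms facts l h by (simp_all add: adjust_parts_def Let_def split: if_splits)
qed

text \<open>A call pays at most \<open>K\<close> for the pivot, \<open>6 * K + 4 * L\<close> for
  adjusting the parts, 1 for administration, and \<open>K + 1\<close> per entry for partitioning and
  the insertion scans. All of this is charged per entry.\<close>

definition partition_cost :: nat where
  "partition_cost = 8 * K + 4 * L + 2"

text \<open>Isolates one unfolding of \<open>pdq\<close>, so that the inductions on the final array
  and on the cost need only these order relations and bounds.\<close>

lemma pdq_partition_step:
  assumes ab: "a \<le> b" "b \<le> length A" and m: "c < b - a" and t: "t \<noteq> 0"
  obtains left r q lo hi w t' finished A' where
    "pdq A a b t =
       (if finished then (A', w)
        else if left then let (A1, v1) = pdq A' (a + r + 1) b t' in (A1, w + v1)
        else let (A1, v1) = pdq A' a (a + r) t'; (A2, v2) = pdq A1 (a + r + 1) b t'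
             in (A2, w + v1 + v2))"
    and "A' = overwrite A a (lo @ q # hi)"
    and "left \<longleftrightarrow> a > 0 \<and> compares_equal lt (A ! (a - 1)) q"
    and "r < b - a" "length lo = r" "length hi = b - a - r - 1"
    and "q \<in> set (slice A a b)" "set lo \<subseteq> set (slice A a b)" "set hi \<subseteq> set (slice A a b)"
    and "t \<le> t' + 1" "w \<le> partition_cost * (b - a)"
    and "left \<longrightarrow> (\<forall>x\<in>set hi. lt q x)"
    and "\<not> left \<longrightarrow> (\<forall>x\<in>set lo. lt x q)"
    and "\<not> left \<longrightarrow> (\<forall>x\<in>set hi. \<not> lt x q)"
proof -
  define xs where "xs = slice A a b"
  have len: "length xs = b - a"
    using ab by (simp add: xs_def length_slice)
  obtain f w1 where sel: "select_pivot xs = (f, w1)"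
    by fastforce
  define ys where "ys = permute_list f xs"
  define q where "q = ys ! 0"
  define left where "left \<longleftrightarrow> a > 0 \<and> compares_equal lt (A ! (a - 1)) q"
  obtain g r w2 where part: "(if left then partition_left ys else partition_right ys) = (g, r, w2)"
    by (metis prod_cases3)
  define zs where "zs = permute_list g ys"
  define bad where "bad \<longleftrightarrow> real (min r (b - a - r - 1)) < p * real (b - a)"
  define t' where "t' = (if bad then t - 1 else t)"
  obtain lo hi w3 finished where adj:
    "adjust_parts bad (\<not> left \<and> g = Transposition.transpose 0 r) (take r zs) (drop (Suc r) zs)
       = (lo, hi, w3, finished)"
    by (metis prod_cases4)
  have f: "f permutes {..<length xs}" and w1: "w1 \<le> K"
    using select_pivot[OF _ sel] m len by auto
  have lys: "length ys = b - a" and sys: "set ys = set xs"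
    using len f by (auto simp: ys_def)
  have cys: "c < length ys"
    using lys m by simp
  have g: "g permutes {..<length ys}" and w2: "w2 \<le> K * (b - a)" and r: "r < b - a"
    using part partition_left[OF cys, of g r w2] partition_right[OF cys, of g r w2] lys
    by (auto split: if_splits)
  have lzs: "length zs = b - a" and szs: "set zs = set xs"
    using lys sys g by (auto simp: zs_def)
  have zs_nth: "zs ! i = ys ! g i" if "i < b - a" for i
    using that g lys by (simp add: zs_def permute_list_nth)
  have hi_left: "\<forall>x\<in>set (drop (Suc r) zs). lt q x" if left
    using that part partition_left[OF cys, of g r w2] lys lzs zs_nth
    by (auto simp: in_set_conv_nth q_def)
  have lo_right: "\<forall>x\<in>set (take r zs). lt x q" if "\<not> left"
    using that part partition_right[OF cys, of g r w2] lys lzs zs_nth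
    by (auto simp: in_set_conv_nth q_def)
  have hi_right: "\<forall>x\<in>set (drop (Suc r) zs). \<not> lt x q" if "\<not> left"
    using that part partition_right[OF cys, of g r w2] lys lzs zs_nth
    by (auto simp: in_set_conv_nth q_def)
  note adj' = adjust_parts_length_set_cost[OF adj]
  show thesis
  proof (rule that)
    show "pdq A a b t =
       (if finished then (overwrite A a (lo @ q # hi), 1 + w1 + w2 + w3)
        else if left then let (A1, v1) = pdq (overwrite A a (lo @ q # hi)) (a + r + 1) b t'
          in (A1, 1 + w1 + w2 + w3 + v1)
        else let (A1, v1) = pdq (overwrite A a (lo @ q # hi)) a (a + r) t';
                 (A2, v2) = pdq A1 (a + r + 1) b t'
             in (A2, 1 + w1 + w2 + w3 + v1 + v2))"
      using m[folded not_le] t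
      by (subst pdq.simps)
        (simp only: Let_def xs_def[symmetric] len sel split_conv ys_def[symmetric]
          q_def[symmetric] left_def[symmetric] part zs_def[symmetric] bad_def[symmetric]
          t'_def[symmetric] adj if_False)
    show "q \<in> set (slice A a b)"
      using sys lys r xs_def by (metis gr_implies_not0 neq0_conv nth_mem q_def)
    show "length lo = r" "length hi = b - a - r - 1"
      using adj'(1,2) lzs r by auto
    show "set lo \<subseteq> set (slice A a b)" "set hi \<subseteq> set (slice A a b)"
      using adj'(3,4) szs set_take_subset[of r zs] set_drop_subset[of "Suc r" zs] xs_def by auto
    show "t \<le> t' + 1"
      by (auto simp: t'_def)
    show "1 + w1 + w2 + w3 \<le> partition_cost * (b - a)"
    proof -
      have "w3 \<le> 6 * K + 4 * L + (b - a)"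
        using adj'(5) lzs r by simp
      then have "1 + w1 + w2 + w3 \<le> (7 * K + 4 * L + 1) + (K + 1) * (b - a)"
        using w1 w2 by simp
      \<comment> \<open>\<open>b - a\<close> is at least 1, so the constant part may be charged per
        entry as well.\<close>
      also have "\<dots> \<le> (7 * K + 4 * L + 1) * (b - a) + (K + 1) * (b - a)"
        using r mult_le_mono2[of 1 "b - a" "7 * K + 4 * L + 1"] by auto
      also have "\<dots> = partition_cost * (b - a)"
        unfolding add_mult_distrib[symmetric] by (simp add: partition_cost_def)
      finally show ?thesis .
    qed
  qed (use r left_def hi_left lo_right hi_right adj' in auto)
qed

text \<open>The quadratic bound is a constant here, since at most \<open>c\<close> entries are
  sorted.\<close>

lemma pdq_insertion:
  assumes "a \<le> b" "b \<le> length A" "b - a \<le> c"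
  obtains ys w where "pdq A a b t = (overwrite A a ys, w)" "length ys = b - a"
    "w \<le> 1 + c * (2 * c + 1)"
proof -
  obtain ys w ok where s: "insertion_sort lt \<infinity> (slice A a b) = (ys, w, ok)"
    by (metis prod_cases3)
  have "w \<le> (b - a) * (2 * (b - a) + 1)"
    using insertion_sort_cost[OF s] assms by (simp add: length_slice)
  also have "\<dots> \<le> c * (2 * c + 1)"
    using assms by (intro mult_le_mono) auto
  finally have "w \<le> c * (2 * c + 1)" .
  moreover have "pdq A a b t = (overwrite A a ys, 1 + w)"
    using assms s by (subst pdq.simps) (simp add: length_slice)
  ultimately show thesis
    using that[of ys "1 + w"] insertion_sort_length_set[OF s] assms by (simp add: length_slice)
qed

lemma pdq_heapsort:
  assumes "a \<le> b" "b \<le> length A" "c < b - a"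
  obtains ys w where "pdq A a b 0 = (overwrite A a ys, w)" "length ys = b - a"
    "\<And>s. b - a \<le> 2 ^ s \<Longrightarrow> w \<le> 1 + (b - a) * (10 * (s + 1))"
proof -
  obtain ys w where h: "heapsort lt (slice A a b) = (ys, w)"
    by fastforce
  have "w \<le> (b - a) * (10 * (s + 1))" if "b - a \<le> 2 ^ s" for s
    using heapsort_cost[of "slice A a b" s lt] h assms that by (simp add: length_slice)
  moreover have "pdq A a b 0 = (overwrite A a ys, 1 + w)"
    using assms h by (subst pdq.simps) (simp add: length_slice)
  ultimately show thesis
    using that[of ys "1 + w"] heapsort_length[of lt "slice A a b"] h assms
    by (simp add: length_slice)
qed

text \<open>The second recursive call runs on the array left by the first; this guarantees that the
  right part and the pivot before it have survived the first call.\<close>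

lemma pdq_frame:
  assumes "a \<le> b" "b \<le> length A"
  shows "length (fst (pdq A a b t)) = length A \<and>
    (\<forall>i<length A. i < a \<or> b \<le> i \<longrightarrow> fst (pdq A a b t) ! i = A ! i)"
  using assms
proof (induction "b - a" arbitrary: A a b t rule: less_induct)
  case less
  consider "b - a \<le> c" | "c < b - a" "t = 0" | "c < b - a" "t \<noteq> 0"
    by linarith
  then show ?case
  proof cases
    case 1
    obtain ys w where "pdq A a b t = (overwrite A a ys, w)" "length ys = b - a"
      using pdq_insertion[OF less.prems 1] by metis
    then show ?thesis
      using less.prems by (auto simp: length_overwrite overwrite_nth)
  next
    case 2
    obtain ys w where "pdq A a b 0 = (overwrite A a ys, w)" "length ys = b - a"
      using pdq_heapsort[OF less.prems 2(1)] by metis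
    then show ?thesis
      using less.prems 2 by (auto simp: length_overwrite overwrite_nth)
  next
    case 3
    obtain left r q lo hi w t' finished A' where
      eq: "pdq A a b t =
       (if finished then (A', w)
        else if left then let (A1, v1) = pdq A' (a + r + 1) b t' in (A1, w + v1)
        else let (A1, v1) = pdq A' a (a + r) t'; (A2, v2) = pdq A1 (a + r + 1) b t'
             in (A2, w + v1 + v2))"
      and A': "A' = overwrite A a (lo @ q # hi)"
      and r: "r < b - a" "length lo = r" "length hi = b - a - r - 1"
      by (rule pdq_partition_step[OF less.prems 3]) metis
    have lA': "length A' = length A" and nA': "\<And>i. i < length A \<Longrightarrow> i < a \<or> b \<le> i \<Longrightarrow> A' ! i = A ! i"
      using A' r less.prems by (auto simp: length_overwrite overwrite_nth)
    note lo = less.hyps[of "a + r" a A' t']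
    note hi = less.hyps[of b "a + r + 1" A' t'] less.hyps[of b "a + r + 1" "fst (pdq A' a (a + r) t')" t']
    show ?thesis
      using eq lo hi lA' nA' r less.prems by (auto split: prod.splits)
  qed
qed

section \<open>The cost of a call, by induction on its length\<close>

definition cost_factor :: nat where
  "cost_factor = 2 * partition_cost + 1 + c * (2 * c + 1)"

text \<open>Every recursive call lowers the rank \<open>h\<close> and lowers the counter by at most one, so \<open>h \<le> t\<close>
  is inherited by the calls and excludes heapsort, which is entered with \<open>t = 0 < h\<close>.  When
  \<open>h \<le> t\<close> fails, heapsort is paid for by \<open>W\<close> per element.\<close>

lemma pdq_cost:
  assumes "a \<le> b" "b \<le> length A"
    and "\<forall>x\<in>set (slice A a b). \<forall>y\<in>predecessors A a. \<not> lt x y"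
    and "rank lt (predecessors A a) (set (slice A a b)) \<le> h"
    and "b - a \<le> 2 ^ s" "h \<le> t \<or> 10 * (s + 1) \<le> W"
  shows "snd (pdq A a b t) \<le> cost_factor * ((b - a) * h) + cost_factor + (b - a) * W"
  using assms
proof (induction "b - a" arbitrary: A a b t h rule: less_induct)
  case less
  note ab = less.prems(1,2)
  consider "b - a \<le> c" | "c < b - a" "t = 0" | "c < b - a" "t \<noteq> 0"
    by linarith
  then show ?case
  proof cases
    case 1
    obtain ys w where "pdq A a b t = (overwrite A a ys, w)" "w \<le> 1 + c * (2 * c + 1)"
      using pdq_insertion[OF ab 1] by metis
    then show ?thesis
      by (simp add: cost_factor_def)
  next
    case 2
    obtain ys w where w: "pdq A a b 0 = (overwrite A a ys, w)"
      "w \<le> 1 + (b - a) * (10 * (s + 1))"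
      using pdq_heapsort[OF ab 2(1)] less.prems(5) by metis
    have "slice A a b \<noteq> []"
      using length_slice[OF ab] 2(1) by force
    then have "0 < h"
      using rank_pos[of "set (slice A a b)" lt "predecessors A a"] less.prems(4) by simp
    then have "10 * (s + 1) \<le> W"
      using less.prems(6) 2 by simp
    then have "(b - a) * (10 * (s + 1)) \<le> (b - a) * W"
      by (rule mult_le_mono2)
    moreover have "1 \<le> cost_factor"
      by (simp add: cost_factor_def)
    ultimately have "w \<le> cost_factor + (b - a) * W"
      using w(2) by linarith
    then show ?thesis
      using w 2 by simp
  next
    case 3
    obtain left r q lo hi w t' finished A' where
      eq: "pdq A a b t =
       (if finished then (A', w)
        else if left then let (A1, v1) = pdq A' (a + r + 1) b t' in (A1, w + v1)
        else let (A1, v1) = pdq A' a (a + r) t'; (A2, v2) = pdq A1 (a + r + 1) b t'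
             in (A2, w + v1 + v2))"
      and A': "A' = overwrite A a (lo @ q # hi)"
      and left: "left \<longleftrightarrow> a > 0 \<and> compares_equal lt (A ! (a - 1)) q"
      and r: "r < b - a" "length lo = r" "length hi = b - a - r - 1"
      and sub: "q \<in> set (slice A a b)" "set lo \<subseteq> set (slice A a b)" "set hi \<subseteq> set (slice A a b)"
      and t': "t \<le> t' + 1" and w: "w \<le> partition_cost * (b - a)"
      and hi_left: "left \<longrightarrow> (\<forall>x\<in>set hi. lt q x)"
      and lo_right: "\<not> left \<longrightarrow> (\<forall>x\<in>set lo. lt x q)"
      and hi_right: "\<not> left \<longrightarrow> (\<forall>x\<in>set hi. \<not> lt x q)"
      by (rule pdq_partition_step[OF ab 3]) (rule that; assumption)
    define A1 where "A1 = fst (pdq A' a (a + r) t')"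
    define P where "P = predecessors A a"
    define S where "S = set (slice A a b)"
    have lA': "length A' = length A"
      using A' r ab by (simp add: length_overwrite)
    have nA': "A' ! i = (if a \<le> i \<and> i < b then (lo @ q # hi) ! (i - a) else A ! i)"
      if "i < length A" for i
      using A' r ab that by (auto simp: overwrite_nth)
    \<comment> \<open>The range from \<open>a + r\<close> on includes the pivot position, so the
      predecessor of the right part also survives the left call.\<close>
    have A1: "length A1 = length A" "\<And>i. i < length A \<Longrightarrow> a + r \<le> i \<Longrightarrow> A1 ! i = A' ! i"
      using pdq_frame[of a "a + r" A' t'] lA' r ab by (auto simp: A1_def)
    have slice_lo: "slice A' a (a + r) = lo"
      using r ab lA' nA' by (intro nth_equalityI) (auto simp: length_slice slice_nth nth_append)
    have slice_hi: "slice A' (a + r + 1) b = hi"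
      using r ab lA' nA'
      by (intro nth_equalityI) (auto simp: length_slice slice_nth nth_append nth_Cons')
    have slice_hi1: "slice A1 (a + r + 1) b = hi"
      unfolding slice_hi[symmetric] using r ab lA' A1 by (intro slice_eqI) auto
    have pred_lo: "predecessors A' a = P"
      using nA'[of "a - 1"] r ab by (auto simp: predecessors_def P_def)
    have pred_hi: "predecessors A' (a + r + 1) = {q}"
      using nA'[of "a + r"] r ab by (auto simp: predecessors_def nth_append)
    have pred_hi1: "predecessors A1 (a + r + 1) = {q}"
      using pred_hi A1(2)[of "a + r"] r ab by (auto simp: predecessors_def)
    have asym: "lt x y \<Longrightarrow> \<not> lt y x" for x y
      using order transpD[of lt x y x] by (auto simp: strict_weak_order_def irreflp_def)
    have above: "\<forall>x\<in>S. \<forall>y\<in>P. \<not> lt x y" and rank_h: "rank lt P S \<le> h"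
      using less.prems(3,4) by (auto simp: P_def S_def)
    have finS: "finite S"
      by (simp add: S_def)
    have hi_above: "\<forall>x\<in>set hi. \<not> lt x q"
      using hi_left hi_right asym by blast
    have rank_hi: "rank lt {q} (set hi) < rank lt P S"
    proof (cases left)
      case True
      \<comment> \<open>The old predecessor compares equal to \<open>q\<close>, so taking
        \<open>q\<close> as the new one excludes the same class.\<close>
      have "value_class lt ` P \<subseteq> value_class lt ` {q}"
        using True left by (auto simp: P_def predecessors_def value_class_eq_iff[OF order])
      then show ?thesis
        using sub hi_left True finS
        by (intro rank_less_if_pivot_value_removed[OF order, of _ _ q])
          (auto simp: S_def compares_equal_def)
    next
      case False
      \<comment> \<open>\<open>q\<close> is an entry and so not below a predecessor; as it does not
        compare equal to it either, it is strictly above.\<close>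
      have "\<forall>y\<in>P. lt y q"
        using False left above sub(1)
        by (auto simp: P_def S_def predecessors_def compares_equal_def split: if_splits)
      then show ?thesis
        using sub hi_above finS by (intro rank_less_if_above_new_pivot[OF order]) (auto simp: S_def)
    qed
    have rank_lo: "rank lt P (set lo) < rank lt P S" if "\<not> left"
      using sub lo_right that finS
      by (intro rank_less_if_pivot_value_removed[OF order, of _ _ q])
        (auto simp: S_def compares_equal_def)
    \<comment> \<open>The strict decrease of the rank makes \<open>h\<close> positive; the parts
      recursed on have rank at most \<open>h'\<close>.\<close>
    obtain h' where h': "h = Suc h'"
      using rank_hi rank_h by (cases h) auto
    have counter: "h' \<le> t' \<or> 10 * (s + 1) \<le> W"
      using less.prems(6) t' h' by auto
    let ?D = cost_factor
    \<comment> \<open>Stated for any \<open>B\<close>, as the right call starts from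
      \<open>A'\<close> after \<open>partition_left\<close> and from \<open>A1\<close> after
      \<open>partition_right\<close>.\<close>
    have hi_cost: "snd (pdq B (a + r + 1) b t') \<le> ?D * ((b - a - r - 1) * h') + ?D + (b - a - r - 1) * W"
      if "length B = length A" "slice B (a + r + 1) b = hi" "predecessors B (a + r + 1) = {q}" for B
      using less.hyps[of b "a + r + 1" B h' t'] that r ab hi_above rank_hi rank_h h' counter
        less.prems(5) by (simp add: diff_diff_left)
    have lo_cost: "snd (pdq A' a (a + r) t') \<le> ?D * (r * h') + ?D + r * W" if "\<not> left"
    proof -
      have "\<forall>x\<in>set lo. \<forall>y\<in>P. \<not> lt x y"
        using above sub(2) by (auto simp: S_def)
      then show ?thesis
        using less.hyps[of "a + r" a A' h' t'] r(1) ab lA' slice_lo pred_lo rank_lo[OF that]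
          rank_h h' counter less.prems(5) by simp
    qed
    define l where "l = b - a - r - 1"
    have ba: "b - a = r + l + 1" "2 \<le> r + l"
      using r 3(1) threshold by (auto simp: l_def)
    \<comment> \<open>The drop from \<open>h\<close> to \<open>h'\<close> frees
      \<open>?D * (b - a)\<close>. Half of it covers \<open>w\<close>; the other half covers one
      extra \<open>?D\<close>, since two calls bring in two additive constants where only one is
      allowed.\<close>
    have "2 * (partition_cost * (b - a)) \<le> ?D * (b - a)"
      by (simp add: cost_factor_def algebra_simps)
    moreover have "2 * ?D + ?D * (r + l) \<le> 2 * (?D * (r + l))"
      using ba(2) mult_le_mono2[OF ba(2), of ?D] by linarith
    ultimately have "w + ?D \<le> ?D * (b - a)"
      using w ba(1) by (simp add: algebra_simps)
    \<comment> \<open>Both calls are counted here, which also covers the outcomes with one call or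
      none.\<close>
    then have main: "w + (?D * (r * h') + ?D + r * W) + (?D * (l * h') + ?D + l * W)
        \<le> ?D * ((b - a) * h) + ?D + (b - a) * W"
      unfolding h' ba(1) by (simp add: algebra_simps)
    show ?thesis
      using eq main lo_cost hi_cost[OF lA' slice_hi pred_hi] hi_cost[OF A1(1) slice_hi1 pred_hi1]
      by (auto simp: A1_def l_def split: prod.splits if_splits)
  qed
qed

section \<open>The top-level call and the bound for the whole run\<close>

lemma running_time_bound:
  assumes "A \<noteq> []"
  shows "running_time A \<le> (3 * cost_factor + 40) * (length A * card (distinct_values lt A))"
proof -
  define n where "n = length A"
  define k where "k = card (distinct_values lt A)"
  define t where "t = nat \<lfloor>log 2 (real n)\<rfloor>"
  have n: "1 \<le> n"
    using assms by (simp add: n_def Suc_le_eq)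
  have rank_k: "rank lt {} (set A) \<le> 2 * k"
    unfolding k_def by (rule rank_le_twice_distinct_values[OF order])
  then have k: "1 \<le> k"
    using rank_pos[of "set A" lt "{}"] assms by auto
  \<comment> \<open>Rounding down loses less than 1, which is why \<open>s = t + 1\<close> is taken
    below.\<close>
  have "log 2 (real n) < real (t + 1)"
    unfolding t_def using n by (simp; linarith)
  then have "real n < 2 powr real (t + 1)"
    using n by (simp add: log_less_iff)
  then have "real n < real (2 ^ (t + 1))"
    using powr_realpow[of 2 "t + 1"] by simp
  then have n_le: "n \<le> 2 ^ (t + 1)"
    by linarith
  \<comment> \<open>Here \<open>h = 2 * k\<close>, \<open>s = t + 1\<close> and
    \<open>W = 10 * (2 * k + 2)\<close>. If \<open>h \<le> t\<close> fails, then
    \<open>t < 2 * k\<close> and hence \<open>10 * (s + 1) \<le> W\<close>.\<close>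
  have "snd (pdq A 0 n t) \<le> cost_factor * ((n - 0) * (2 * k)) + cost_factor + (n - 0) * (10 * (2 * k + 2))"
  proof (rule pdq_cost)
    show "rank lt (predecessors A 0) (set (slice A 0 n)) \<le> 2 * k"
      using rank_k by (simp add: predecessors_def slice_def n_def)
    show "n - 0 \<le> 2 ^ (t + 1)"
      using n_le by simp
  qed (auto simp: predecessors_def n_def)
  \<comment> \<open>Two multiples of \<open>cost_factor\<close> come from \<open>h = 2 * k\<close>
    and one from the additive constant; the 40 comes from \<open>W \<le> 40 * k\<close>.\<close>
  also have "\<dots> \<le> (3 * cost_factor + 40) * (n * k)"
  proof -
    have nk: "1 \<le> n * k" "n \<le> n * k"
      using n k by simp_all
    have "cost_factor * 1 \<le> cost_factor * (n * k)"
      using nk(1) by (rule mult_le_mono2)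
    moreover have "20 * n \<le> 20 * (n * k)"
      using nk(2) by (rule mult_le_mono2)
    moreover have "(3 * cost_factor + 40) * (n * k) =
        cost_factor * (n * (2 * k)) + cost_factor * (n * k) + 20 * (n * k) + 20 * (n * k)"
      by (simp add: algebra_simps)
    moreover have "n * (10 * (2 * k + 2)) = 20 * (n * k) + 20 * n"
      by (simp add: algebra_simps)
    ultimately show ?thesis
      unfolding diff_zero mult_1_right by linarith
  qed
  finally show ?thesis
    by (simp add: running_time_def n_def k_def t_def)
qed

end

theorem theorem1:
  fixes c L K :: nat and p :: real
  shows "\<exists>C :: real. \<forall>(lt :: 'a \<Rightarrow> 'a \<Rightarrow> bool) select_pivot partition_left partition_right
             swaps_left swaps_right.
           pdqsort lt c p K select_pivot partition_left partition_right swaps_left swaps_right \<longrightarrow>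
           (\<forall>(A :: 'a list) n k.
              length A = n \<and> n \<ge> 1 \<and> card (distinct_values lt A) = k \<longrightarrow>
              real (pdqsort.running_time lt c p L select_pivot partition_left partition_right
                      swaps_left swaps_right A) \<le> C * real n * real k)"
proof (intro exI allI impI, elim conjE)
  fix lt :: "'a \<Rightarrow> 'a \<Rightarrow> bool"
    and select_pivot partition_left partition_right swaps_left swaps_right
    and A :: "'a list" and n k :: nat
  assume pdq: "pdqsort lt c p K select_pivot partition_left partition_right swaps_left swaps_right"
    and A: "length A = n" "1 \<le> n" "card (distinct_values lt A) = k"
  interpret pdqsort lt c p L K select_pivot partition_left partition_right swaps_left swaps_right
    by (rule pdq)
  have "A \<noteq> []"
    using A by auto
  from running_time_bound[OF this]
  have "real (running_time A) \<le> real ((3 * cost_factor + 40) * (n * k))"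
    using A by (simp only: of_nat_le_iff)
  \<comment> \<open>The witness for \<open>C\<close> involves only \<open>c\<close>,
    \<open>L\<close> and \<open>K\<close>, so one constant serves all orderings, subroutines and
    arrays.\<close>
  then show "real (running_time A)
      \<le> real (3 * (2 * (8 * K + 4 * L + 2) + 1 + c * (2 * c + 1)) + 40) * real n * real k"
    by (simp add: cost_factor_def partition_cost_def mult.assoc)
qed

end
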